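(* In the discretized two-slope ski rental problem with tail constraint $(\gamma,\delta)$ described in the context, if $\delta<\frac{\mathrm{OPT}-1}{\frac1a-1}$ then every optimal solution is in world 2.
   Context: Fix $0\le a<1$ and $(\gamma,\delta)$ with $2-a\le\gamma<1/a$, $0\le\delta\le1$. A purchase distribution $f$ gives probabilities $f_t$ of switching at time $t$ and $f_\infty$ of never switching. For buying time $t$ and stopping time $x>0$: $\alpha(t,x)=\frac{t+1-a+a(x-t)}{x}$ if $t\le x\le1$; $1$ if $t>x$, $x\le1$; $\frac{t+1-a+a(x-t)}{1-a+ax}$ if $t\le x$, $x>1$; $\frac{x}{1-a+ax}$ if $t>x$, $x>1$ (incl. $t=\infty$); $\alpha(t,\infty)=1$ for finite $t$, $\alpha(\infty,\infty)=1/a$. $\alpha_f(x)=\mathbb{E}_{t\sim f}\alpha(t,x)$. Bad interval $I_\gamma(x)=\{t:\alpha(t,x)>\gamma\}$; $f$ feasible if $\sum_{t\in I_\gamma(x)}f_t\le\delta$ for all $x$. $\mathrm{OPT}=\min_{f\text{ feasible}}\sup_x\alpha_f(x)$; an optimal solution is a feasible $f$ attaining it. Discretization: a sufficiently small step $\tau>0$ is fixed (with $1$ a multiple of $\tau$); distributions are supported on $\{\tau,2\tau,\dots\}\cup\{\infty\}$. For an optimal solution $f$, the value $\beta(f)=\frac{1+\tau}{1-a+a(1+\tau)}+\sum_{t\le1}\frac{(1-a)(t-\tau)}{1-a+a(1+\tau)}f_t$ is the competitive ratio at time $1+\tau$ that would result from placing zero mass at $1+\tau$; $f$ is in world 1 if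 $\beta(f)=\mathrm{OPT}$ (so zero mass must be placed at $1+\tau$) and in world 2 if $\beta(f)<\mathrm{OPT}$ (so nonzero mass can be placed at $1+\tau$). *)

theory Defs
  imports "HOL-Probability.Probability"
begin

text \<open>
  Buying and stopping times are positive extended reals, where \<open>\<infinity>\<close> means never switching
  (respectively never stopping). Arithmetic is that of \<^typ>\<open>ereal\<close>, so \<open>1 / a = \<infinity>\<close> for \<open>a = 0\<close>;
  only the branch \<open>t = x = \<infinity>\<close> can produce an infinite value when \<open>t\<close> and \<open>x\<close> are positive.
\<close>

definition ratio :: "real \<Rightarrow> ereal \<Rightarrow> ereal \<Rightarrow> ereal" where
  "ratio a t x =
    (if x = \<infinity> then (if t = \<infinity> then 1 / ereal a else 1)
     else if x \<le> 1 then
       (if t \<le> x then (t + 1 - ereal a + ereal a * (x - t)) / x else 1)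
     else
       (if t \<le> x then (t + 1 - ereal a + ereal a * (x - t)) / (1 - ereal a + ereal a * x)
        else x / (1 - ereal a + ereal a * x)))"

text \<open>
  The expectation is a nonnegative integral because \<open>ratio 0 \<infinity> \<infinity> = \<infinity>\<close>. The conversion
  \<^const>\<open>e2ennreal\<close> loses nothing: the ratio is at least \<open>1\<close> for positive times and \<open>0 \<le> a < 1\<close>.
\<close>

definition expected_ratio :: "real \<Rightarrow> ereal pmf \<Rightarrow> ereal \<Rightarrow> ereal" where
  "expected_ratio a f x = enn2ereal (\<integral>\<^sup>+ t. e2ennreal (ratio a t x) \<partial>measure_pmf f)"

definition competitive_ratio :: "real \<Rightarrow> ereal pmf \<Rightarrow> ereal" where
  "competitive_ratio a f = (SUP x\<in>{0<..}. expected_ratio a f x)"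

definition bad_interval :: "real \<Rightarrow> real \<Rightarrow> ereal \<Rightarrow> ereal set" where
  "bad_interval a \<gamma> x = {t. ratio a t x > ereal \<gamma>}"

definition grid :: "real \<Rightarrow> real set" where
  "grid \<tau> = {real k * \<tau> | k. 1 \<le> k}"

definition feasible :: "real \<Rightarrow> real \<Rightarrow> real \<Rightarrow> real \<Rightarrow> ereal pmf \<Rightarrow> bool" where
  "feasible \<tau> a \<gamma> \<delta> f \<longleftrightarrow>
     set_pmf f \<subseteq> ereal ` grid \<tau> \<union> {\<infinity>} \<and>
     (\<forall>x>0. measure_pmf.prob f (bad_interval a \<gamma> x) \<le> \<delta>)"

definition OPT :: "real \<Rightarrow> real \<Rightarrow> real \<Rightarrow> real \<Rightarrow> ereal" where
  "OPT \<tau> a \<gamma> \<delta> = (INF f\<in>{f. feasible \<tau> a \<gamma> \<delta> f}. competitive_ratio a f)"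

definition optimal :: "real \<Rightarrow> real \<Rightarrow> real \<Rightarrow> real \<Rightarrow> ereal pmf \<Rightarrow> bool" where
  "optimal \<tau> a \<gamma> \<delta> f \<longleftrightarrow>
     feasible \<tau> a \<gamma> \<delta> f \<and> competitive_ratio a f = OPT \<tau> a \<gamma> \<delta>"

text \<open>
  \<open>beta \<tau> a f\<close> is the expected ratio at stopping time \<open>1 + \<tau>\<close> after all mass that \<open>f\<close> places
  at \<open>1 + \<tau>\<close> has been moved to later times.
\<close>

definition beta :: "real \<Rightarrow> real \<Rightarrow> ereal pmf \<Rightarrow> real" where
  "beta \<tau> a f = (1 + \<tau>) / (1 - a + a * (1 + \<tau>)) +
     (\<Sum>t\<in>{t \<in> grid \<tau>. t \<le> 1}. (1 - a) * (t - \<tau>) / (1 - a + a * (1 + \<tau>)) * pmf f (ereal t))"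

definition world1 :: "real \<Rightarrow> real \<Rightarrow> real \<Rightarrow> real \<Rightarrow> ereal pmf \<Rightarrow> bool" where
  "world1 \<tau> a \<gamma> \<delta> f \<longleftrightarrow> ereal (beta \<tau> a f) = OPT \<tau> a \<gamma> \<delta>"

definition world2 :: "real \<Rightarrow> real \<Rightarrow> real \<Rightarrow> real \<Rightarrow> ereal pmf \<Rightarrow> bool" where
  "world2 \<tau> a \<gamma> \<delta> f \<longleftrightarrow> ereal (beta \<tau> a f) < OPT \<tau> a \<gamma> \<delta>"

end

theory Submission
  imports Defs
begin

text \<open>
  For \<open>x \<ge> 1\<close>, the expected ratio \<open>\<alpha>\<^sub>f(x)\<close> satisfies
  \<open>(1 - a + a x) \<alpha>\<^sub>f(x) = x + (1 - a) (\<Sum>t\<le>x. (t + 1 - x) f\<^sub>t)\<close>. Let \<open>L(x)\<close> be the right-hand side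
  with the sum restricted to \<open>t \<le> 1\<close>, minus \<open>OPT (1 - a + a x)\<close>; it is affine in \<open>x\<close>. Optimality
  gives \<open>L(1) \<le> 0\<close>, and if \<open>f\<close> is not in world 2 then \<open>L(1 + \<tau>) \<ge> 0\<close>, so \<open>L \<ge> 0\<close> on
  \<open>[1 + \<tau>, \<infinity>)\<close>. At the first finite atom \<open>t > 1\<close> the ratio would then exceed \<open>OPT\<close> by
  \<open>(1 - a) f\<^sub>t / (1 - a + a t)\<close>; hence there is no such atom, and all mass beyond \<open>1\<close> sits at \<open>\<infinity>\<close>.
  The slope of \<open>L\<close> is now \<open>a + (1 - a) f\<^sub>\<infinity> - a OPT \<ge> 0\<close>, that is
  \<open>OPT \<le> 1 + (1/a - 1) f\<^sub>\<infinity> \<le> 1 + (1/a - 1) \<delta>\<close>.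
\<close>

lemma finite_grid_le:
  assumes "0 < \<tau>"
  shows "finite {t \<in> grid \<tau>. t \<le> x}"
proof -
  have "{t \<in> grid \<tau>. t \<le> x} \<subseteq> (\<lambda>k. real k * \<tau>) ` {.. nat \<lfloor>x / \<tau>\<rfloor>}"
  proof
    fix t assume "t \<in> {t \<in> grid \<tau>. t \<le> x}"
    then obtain k where k: "t = real k * \<tau>" "real k * \<tau> \<le> x"
      unfolding grid_def by auto
    then have "real k \<le> x / \<tau>" using assms by (simp add: field_simps)
    then have "k \<le> nat \<lfloor>x / \<tau>\<rfloor>" by (simp add: le_nat_floor)
    then show "t \<in> (\<lambda>k. real k * \<tau>) ` {.. nat \<lfloor>x / \<tau>\<rfloor>}" using k by auto
  qed
  then show ?thesis using finite_subset by blast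
qed

text \<open>For stopping times at least 1 every ratio has the denominator
  \<open>1 - a + a * x\<close>; having bought at s \<le> x only adds (1 - a) (s + 1 - x) to the
  numerator x. Only finitely many grid points are at most x, so the ratio is a finite combination of
  indicators on the support, and \<open>\<infinity>\<close> needs no separate term.\<close>

lemma expected_ratio_ereal:
  assumes a: "0 \<le> a" "a < 1" and x: "1 \<le> x" and \<tau>: "0 < \<tau>"
    and supp: "set_pmf f \<subseteq> ereal ` grid \<tau> \<union> {\<infinity>}"
  shows "expected_ratio a f (ereal x) =
    ereal ((x + (1 - a) * (\<Sum>s\<in>{s \<in> grid \<tau>. s \<le> x}. (s + 1 - x) * pmf f (ereal s))) / (1 - a + a * x))"
proof -
  let ?A = "{s \<in> grid \<tau>. s \<le> x}" and ?D = "1 - a + a * x"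
  define h where "h t = (x + (1 - a) * (\<Sum>s\<in>?A. (s + 1 - x) * indicator {ereal s} t)) / ?D" for t
  have fin: "finite ?A" using finite_grid_le[OF \<tau>] .
  have "a * 1 \<le> a * x" using a x by (intro mult_left_mono) auto
  then have D: "?D > 0" by simp
  have h_eq: "ratio a t (ereal x) = ereal (h t) \<and> 0 \<le> h t" if t: "t \<in> set_pmf f" for t
  proof (cases "t \<le> ereal x")
    case True
    then obtain s where s: "s \<in> grid \<tau>" "t = ereal s" "s \<le> x"
      using supp t by auto
    have "s > 0" using s(1) \<tau> unfolding grid_def by auto
    have "(\<Sum>u\<in>?A. (u + 1 - x) * indicator {ereal u} t) = (\<Sum>u\<in>?A. if s = u then u + 1 - x else 0)"
      using s by (intro sum.cong) (auto simp: indicator_def)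
    also have "\<dots> = s + 1 - x" using s fin by simp
    finally have h: "h t = (x + (1 - a) * (s + 1 - x)) / ?D" unfolding h_def by simp
    have num: "x + (1 - a) * (s + 1 - x) = s + 1 - a + a * (x - s)" by (simp add: algebra_simps)
    have "0 \<le> a * (x - s)" using a s by simp
    then have "h t \<ge> 0" using h num D a \<open>s > 0\<close> by simp
    moreover have "ratio a t (ereal x) = ereal (h t)"
    \<comment> \<open>At x = 1 \<open>ratio\<close> takes its \<open>x \<le> 1\<close> branch, which
      agrees since the denominator is then 1.\<close>
    proof (cases "x = 1")
      case True
      then show ?thesis using s h num by (simp add: ratio_def one_ereal_def)
    next
      case False
      then show ?thesis using s h num D x by (simp add: ratio_def one_ereal_def)
    qed
    ultimately show ?thesis by simp
  next
    case False
    have "(\<Sum>u\<in>?A. (u + 1 - x) * indicator {ereal u} t) = 0"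
      using False by (intro sum.neutral) (auto simp: indicator_def)
    then have h: "h t = x / ?D" unfolding h_def by simp
    then have "ratio a t (ereal x) = ereal (h t)"
      using False x D by (cases "x = 1") (auto simp: ratio_def one_ereal_def)
    then show ?thesis using h x D by simp
  qed
  have ind: "integrable (measure_pmf f) (\<lambda>t. (s + 1 - x) * indicator {ereal s} t :: real)" for s
    by (intro integrable_mult_right) (auto simp: measure_pmf.integrable_const_bound[where B = 1])
  then have int: "integrable (measure_pmf f) (\<lambda>t. \<Sum>s\<in>?A. (s + 1 - x) * indicator {ereal s} t :: real)"
    by (intro Bochner_Integration.integrable_sum)
  then have inth: "integrable (measure_pmf f) h"
    unfolding h_def by (intro integrable_divide Bochner_Integration.integrable_add integrable_mult_right) auto
  have "(\<integral>\<^sup>+ t. e2ennreal (ratio a t (ereal x)) \<partial>measure_pmf f) = (\<integral>\<^sup>+ t. ennreal (h t) \<partial>measure_pmf f)"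
    using h_eq by (intro nn_integral_cong_AE) (auto simp: AE_measure_pmf_iff)
  also have "\<dots> = ennreal (integral\<^sup>L (measure_pmf f) h)"
    using h_eq inth by (intro nn_integral_eq_integral) (auto simp: AE_measure_pmf_iff)
  finally have "expected_ratio a f (ereal x) = ereal (integral\<^sup>L (measure_pmf f) h)"
    unfolding expected_ratio_def
    using h_eq by (simp add: integral_nonneg_AE AE_measure_pmf_iff)
  moreover have "integral\<^sup>L (measure_pmf f) h =
      (x + (1 - a) * (\<Sum>s\<in>?A. (s + 1 - x) * pmf f (ereal s))) / ?D"
    unfolding h_def using int ind
    by (simp add: Bochner_Integration.integral_sum measure_pmf_single)
  ultimately show ?thesis by simp
qed

theorem theorem13:
  fixes a \<gamma> \<delta> :: real
  assumes "0 \<le> a" and "a < 1"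
    and "2 - a \<le> \<gamma>" and "ereal \<gamma> < 1 / ereal a"
    and "0 \<le> \<delta>" and "\<delta> \<le> 1"
  shows "\<exists>\<tau>\<^sub>0>0. \<forall>\<tau>::real. 0 < \<tau> \<and> \<tau> < \<tau>\<^sub>0 \<and> (\<exists>n::nat. real n * \<tau> = 1) \<longrightarrow>
           ereal \<delta> < (OPT \<tau> a \<gamma> \<delta> - 1) / (1 / ereal a - 1) \<longrightarrow>
           (\<forall>f. optimal \<tau> a \<gamma> \<delta> f \<longrightarrow> world2 \<tau> a \<gamma> \<delta> f)"
\<comment> \<open>The argument is uniform in the step, so 1 serves as threshold.\<close>
proof (intro exI[of _ "1::real"] conjI allI impI)
  fix \<tau> :: real and f
  assume "0 < \<tau> \<and> \<tau> < 1 \<and> (\<exists>n::nat. real n * \<tau> = 1)"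
    and \<delta>: "ereal \<delta> < (OPT \<tau> a \<gamma> \<delta> - 1) / (1 / ereal a - 1)"
    and opt: "optimal \<tau> a \<gamma> \<delta> f"
  then obtain n :: nat where \<tau>: "0 < \<tau>" and n: "real n * \<tau> = 1" by blast
  \<comment> \<open>For a = 0 the divisor is \<open>\<infinity>\<close>, and an \<open>ereal\<close>
    quotient by \<open>\<infinity>\<close> is 0, so the assumption would read \<delta> < 0.\<close>
  have "a \<noteq> 0"
  proof
    assume "a = 0"
    then have "(1 / ereal a - 1) = \<infinity>" by (simp add: divide_ereal_def zero_ereal_def[symmetric])
    then show False using \<delta> \<open>0 \<le> \<delta>\<close> by simp
  qed
  then have a: "0 < a" "a < 1" using assms by auto
  have supp: "set_pmf f \<subseteq> ereal ` grid \<tau> \<union> {\<infinity>}"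
    and tail: "measure_pmf.prob f (bad_interval a \<gamma> \<infinity>) \<le> \<delta>"
    and comp: "competitive_ratio a f = OPT \<tau> a \<gamma> \<delta>"
    using opt unfolding optimal_def feasible_def by auto
  \<comment> \<open>Never switching has ratio 1/a > \<gamma> at x = \<open>\<infinity>\<close>; this
    is how the tail constraint caps the mass at \<open>\<infinity>\<close>.\<close>
  have "\<infinity> \<in> bad_interval a \<gamma> \<infinity>"
    using assms(4) by (simp add: bad_interval_def ratio_def)
  then have "measure_pmf.prob f {\<infinity>} \<le> measure_pmf.prob f (bad_interval a \<gamma> \<infinity>)"
    by (intro measure_pmf.finite_measure_mono) auto
  then have f_inf: "pmf f \<infinity> \<le> \<delta>" using tail by (simp add: measure_pmf_single)
  show "world2 \<tau> a \<gamma> \<delta> f"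
  proof (rule ccontr)
    assume "\<not> world2 \<tau> a \<gamma> \<delta> f"
    then have OPT_le: "OPT \<tau> a \<gamma> \<delta> \<le> ereal (beta \<tau> a f)" by (simp add: world2_def)
    have le_OPT: "expected_ratio a f (ereal x) \<le> OPT \<tau> a \<gamma> \<delta>" if "1 \<le> x" for x
      unfolding comp[symmetric] competitive_ratio_def using that by (intro SUP_upper) auto
    have "OPT \<tau> a \<gamma> \<delta> \<ge> 0"
      using order_trans[OF _ le_OPT[of 1]] unfolding expected_ratio_def by simp
    with OPT_le obtain K where K: "OPT \<tau> a \<gamma> \<delta> = ereal K"
      by (cases "OPT \<tau> a \<gamma> \<delta>") auto
    \<comment> \<open>With mass P and first moment M on [\<tau>, 1], L(x) = x + (1 - a) (M + (1 - x)
      P) - K (1 - a + a x), whose slope is 1 - (1 - a) P - a K.\<close>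
    define A where "A = {t \<in> grid \<tau>. t \<le> 1}"
    define P where "P = (\<Sum>s\<in>A. pmf f (ereal s))"
    define M where "M = (\<Sum>s\<in>A. s * pmf f (ereal s))"
    have finA: "finite A" unfolding A_def using finite_grid_le[OF \<tau>] .
    have sum_A: "(\<Sum>s\<in>A. (s + 1 - x) * pmf f (ereal s)) = M + (1 - x) * P" for x
      unfolding M_def P_def by (simp add: sum_distrib_left algebra_simps sum.distrib sum_subtractf)
    have bound: "x + (1 - a) * (\<Sum>s\<in>{s \<in> grid \<tau>. s \<le> x}. (s + 1 - x) * pmf f (ereal s))
        \<le> K * (1 - a + a * x)" if "1 \<le> x" for x
    proof -
      have "a * 1 \<le> a * x" using a that by (intro mult_left_mono) auto
      then have "1 - a + a * x > 0" by simp
      then show ?thesis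
        using le_OPT[OF that] expected_ratio_ereal[OF _ _ that \<tau> supp, of a] a K
        by (simp add: pos_divide_le_eq)
    qed
    have L1: "1 + (1 - a) * M \<le> K"
      using bound[of 1] sum_A[of 1] unfolding A_def by simp
    have D: "1 - a + a * (1 + \<tau>) > 0" using a \<tau> by (simp add: algebra_simps add_pos_pos)
    \<comment> \<open>Since t - \<tau> = t + 1 - (1 + \<tau>), \<open>beta\<close> at least K means
      L(1 + \<tau>) \<ge> 0.\<close>
    have "beta \<tau> a f = (1 + \<tau> + (1 - a) * (\<Sum>s\<in>A. (s + 1 - (1 + \<tau>)) * pmf f (ereal s)))
        / (1 - a + a * (1 + \<tau>))"
      unfolding beta_def A_def[symmetric]
      by (simp add: add_divide_distrib sum_distrib_left sum_divide_distrib mult.assoc)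
    then have Lt: "K * (1 - a + a * (1 + \<tau>)) \<le> 1 + \<tau> + (1 - a) * (M - \<tau> * P)"
      using OPT_le K D sum_A[of "1 + \<tau>"] by (simp add: pos_le_divide_eq)
    \<comment> \<open>This is L(1 + \<tau>) - L(1) \<ge> 0, to be divided by \<tau>.\<close>
    have "\<tau> * (a * K) \<le> \<tau> * (1 - (1 - a) * P)"
      using L1 Lt by (simp add: algebra_simps)
    then have slope: "a * K \<le> 1 - (1 - a) * P" using \<tau> by simp
    \<comment> \<open>As n \<tau> = 1, the indices above n are exactly the times beyond 1; strong
      induction replaces the choice of a first atom.\<close>
    have no_atom: "pmf f (ereal (real k * \<tau>)) = 0" if "n < k" for k
      using that
    proof (induction k rule: less_induct)
      case (less k)
      let ?t = "real k * \<tau>"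
      have "real (n + 1) * \<tau> \<le> ?t" using less.prems \<tau> by (intro mult_right_mono) auto
      then have t: "1 + \<tau> \<le> ?t" using n by (simp add: algebra_simps)
      have "?t \<in> grid \<tau>" using less.prems unfolding grid_def by fastforce
      have "(\<Sum>s\<in>{s \<in> grid \<tau>. s \<le> ?t}. (s + 1 - ?t) * pmf f (ereal s))
          = (\<Sum>s\<in>insert ?t A. (s + 1 - ?t) * pmf f (ereal s))"
      proof (intro sum.mono_neutral_right ballI)
        show "finite {s \<in> grid \<tau>. s \<le> ?t}" using finite_grid_le[OF \<tau>] .
        show "insert ?t A \<subseteq> {s \<in> grid \<tau>. s \<le> ?t}"
          using t \<tau> \<open>?t \<in> grid \<tau>\<close> unfolding A_def by auto
        fix s assume "s \<in> {s \<in> grid \<tau>. s \<le> ?t} - insert ?t A"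
        then obtain j where j: "s = real j * \<tau>" "real j * \<tau> < ?t" "real j * \<tau> > 1"
          unfolding A_def grid_def by fastforce
        then have "real n * \<tau> < real j * \<tau>" using n by simp
        then have "n < j" "j < k" using j \<tau> by auto
        then show "(s + 1 - ?t) * pmf f (ereal s) = 0" using less.IH j by simp
      qed
      also have "\<dots> = pmf f (ereal ?t) + (M + (1 - ?t) * P)"
      proof -
        have "?t \<notin> A" using t \<tau> unfolding A_def by simp
        then show ?thesis using finA sum_A[of ?t] by simp
      qed
      \<comment> \<open>The atom at \<open>?t\<close> enters with coefficient 1, so this says L(t) +
        (1 - a) f(t) \<le> 0 for t = \<open>?t\<close>. The next fact, added to \<open>Lt\<close>,
        gives L(t) \<ge> 0.\<close>
      finally have "?t + (1 - a) * (pmf f (ereal ?t) + (M + (1 - ?t) * P)) \<le> K * (1 - a + a * ?t)"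
        using bound[of ?t] t \<tau> by simp
      moreover have "(?t - (1 + \<tau>)) * (a * K) \<le> (?t - (1 + \<tau>)) * (1 - (1 - a) * P)"
        using slope t by (intro mult_left_mono) auto
      ultimately have "(1 - a) * pmf f (ereal ?t) \<le> 0"
        using Lt by (simp add: algebra_simps)
      then have "pmf f (ereal ?t) \<le> 0" using a by (simp add: mult_le_0_iff)
      then show ?case using pmf_nonneg[of f "ereal ?t"] by simp
    qed
    have "set_pmf f \<subseteq> insert \<infinity> (ereal ` A)"
    proof
      fix u assume u: "u \<in> set_pmf f"
      show "u \<in> insert \<infinity> (ereal ` A)"
      proof (cases "u = \<infinity>")
        case False
        then obtain k where k: "u = ereal (real k * \<tau>)" "1 \<le> k"
          using u supp unfolding grid_def by auto
        then have "k \<le> n" using no_atom[of k] u by (auto simp: set_pmf_eq not_less[symmetric])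
        then have "real k * \<tau> \<le> real n * \<tau>" using \<tau> by simp
        then show ?thesis using k n unfolding A_def grid_def by auto
      qed simp
    qed
    then have "(\<Sum>u\<in>insert \<infinity> (ereal ` A). pmf f u) = 1"
      using finA by (intro sum_pmf_eq_1) auto
    then have "P + pmf f \<infinity> = 1"
      using finA unfolding P_def by (subst (asm) sum.insert) (auto simp: sum.reindex)
    then have "P = 1 - pmf f \<infinity>" by simp
    then have "a * K \<le> 1 - (1 - a) * (1 - pmf f \<infinity>)" using slope by simp
    moreover have "(1 - a) * pmf f \<infinity> \<le> (1 - a) * \<delta>" using a f_inf by simp
    ultimately have "a * (K - 1) \<le> (1 - a) * \<delta>" by (simp add: algebra_simps)
    moreover have "\<delta> < (K - 1) / (1 / a - 1)"
      using \<delta> a unfolding K by (simp add: one_ereal_def)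
    then have "(1 - a) * \<delta> < a * (K - 1)" using a by (simp add: field_simps)
    ultimately show False by simp
  qed
qed simp

end
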